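(* Let $N:\mathbb{R}^n\to\mathbb{R}^n$ be a nilpotent morphism of the form $$N=\pm\left(N_{(1)}-N_{(2)}+\dots+(-1)^{m+1}N_{(m)}\right),$$ where each $N_{(i)}:\mathbb{R}^n\to\mathbb{R}^n$ is defined by positive homogeneous forms of degree $i$. Then $N$ possesses at most one fixed point.
   Context: A morphism (polynomial mapping) $N=(N_1,\dots,N_n):\mathbb{R}^n\to\mathbb{R}^n$ is given by polynomials $N_i\in\mathbb{R}[X_1,\dots,X_n]$. It is nilpotent if its Jacobi matrix $JN(X)=\left(\frac{\partial N_i}{\partial X_j}\right)$ satisfies $(JN(X))^n\equiv 0$ in the ring of $n\times n$ matrices over $\mathbb{R}[X_1,\dots,X_n]$. A homogeneous form is positive if all of its non-zero coefficients are positive (the zero form is allowed). A fixed point of $N$ is a point $x\in\mathbb{R}^n$ with $N(x)=x$. *)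

theory Defs
  imports "HOL-Analysis.Analysis" "HOL-Library.Poly_Mapping"
begin

text \<open>
  Real polynomials in the variables X_i, i :: 'n. An exponent vector is a finitely supported
  map \<^typ>\<open>'n \<Rightarrow>\<^sub>0 nat\<close>; the library's convolution product makes the type below
  a commutative ring.
\<close>

type_synonym 'n mpoly = "('n \<Rightarrow>\<^sub>0 nat) \<Rightarrow>\<^sub>0 real"

text \<open>A polynomial mapping is a tuple of formal polynomials N $ k, k :: 'n, with n = CARD('n).\<close>

type_synonym 'n morphism = "'n mpoly ^ 'n"

definition mpoly_eval :: "'n::finite mpoly \<Rightarrow> real ^ 'n \<Rightarrow> real" where
  "mpoly_eval p x =
     (\<Sum>m\<in>Poly_Mapping.keys p.
        Poly_Mapping.lookup p m * (\<Prod>i\<in>UNIV. (x $ i) ^ Poly_Mapping.lookup m i))"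

text \<open>
  In the next definition the exponent subtraction truncates only if X_j does not occur in the
  monomial, in which case the coefficient is 0.
\<close>

definition mpoly_deriv :: "'n::finite \<Rightarrow> 'n mpoly \<Rightarrow> 'n mpoly" where
  "mpoly_deriv j p =
     (\<Sum>m\<in>Poly_Mapping.keys p.
        Poly_Mapping.single (m - Poly_Mapping.single j 1)
          (of_nat (Poly_Mapping.lookup m j) * Poly_Mapping.lookup p m))"

definition homogeneous_form :: "nat \<Rightarrow> 'n::finite mpoly \<Rightarrow> bool" where
  "homogeneous_form d p \<longleftrightarrow>
     (\<forall>m\<in>Poly_Mapping.keys p. (\<Sum>i\<in>UNIV. Poly_Mapping.lookup m i) = d)"

definition positive_form :: "nat \<Rightarrow> 'n::finite mpoly \<Rightarrow> bool" where
  "positive_form d p \<longleftrightarrow>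
     homogeneous_form d p \<and> (\<forall>m\<in>Poly_Mapping.keys p. Poly_Mapping.lookup p m > 0)"

definition morphism_eval :: "'n::finite morphism \<Rightarrow> real ^ 'n \<Rightarrow> real ^ 'n" where
  "morphism_eval N x = (\<chi> k. mpoly_eval (N $ k) x)"

definition jacobi_matrix :: "'n::finite morphism \<Rightarrow> 'n mpoly ^ 'n ^ 'n" where
  "jacobi_matrix N = (\<chi> i j. mpoly_deriv j (N $ i))"

text \<open>The class operation \<open>^\<close> on vectors is not the power for the matrix product.\<close>

primrec matrix_power :: "'a::semiring_1 ^ 'n ^ 'n \<Rightarrow> nat \<Rightarrow> 'a ^ 'n ^ 'n" where
  "matrix_power A 0 = mat 1"
| "matrix_power A (Suc k) = A ** matrix_power A k"

definition nilpotent_morphism :: "'n::finite morphism \<Rightarrow> bool" where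
  "nilpotent_morphism N \<longleftrightarrow> matrix_power (jacobi_matrix N) CARD('n) = 0"

definition fixed_point :: "'n::finite morphism \<Rightarrow> real ^ 'n \<Rightarrow> bool" where
  "fixed_point N x \<longleftrightarrow> morphism_eval N x = x"

end

theory Submission
  imports Defs
begin

text \<open>
  At the point \<open>(-1,\<dots>,-1)\<close> every term of \<open>\<partial>N\<^sub>i/\<partial>X\<^sub>j\<close> has the same sign, so the
  Jacobi matrix there is, up to a global sign, a nonnegative nilpotent matrix whose \<open>(i,j)\<close> entry
  is positive as soon as \<open>X\<^sub>j\<close> occurs in \<open>N\<^sub>i\<close>. An infinite walk through positive entries would
  make every power of the matrix nonzero, so the relation "\<open>X\<^sub>j\<close> occurs in \<open>N\<^sub>i\<close>" is well-founded,
  and \<open>x = N x\<close> determines the coordinates of \<open>x\<close> by recursion along it.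
\<close>

lemma mpoly_eval_superset:
  assumes "finite S" "Poly_Mapping.keys p \<subseteq> S"
  shows "mpoly_eval p x = (\<Sum>m\<in>S. Poly_Mapping.lookup p m * (\<Prod>i\<in>UNIV. (x $ i) ^ Poly_Mapping.lookup m i))"
  unfolding mpoly_eval_def using assms by (intro sum.mono_neutral_left) (auto simp: in_keys_iff)

lemma mpoly_eval_0 [simp]: "mpoly_eval 0 x = 0"
  by (simp add: mpoly_eval_def)

lemma mpoly_eval_single [simp]:
  "mpoly_eval (Poly_Mapping.single m c) x = c * (\<Prod>i\<in>UNIV. (x $ i) ^ Poly_Mapping.lookup m i)"
  by (simp add: mpoly_eval_def)

lemma mpoly_eval_1 [simp]: "mpoly_eval 1 x = 1"
  unfolding single_one [symmetric] by (simp only: mpoly_eval_single lookup_zero) simp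

lemma mpoly_eval_add: "mpoly_eval (p + q) x = mpoly_eval p x + mpoly_eval q x"
proof -
  let ?S = "Poly_Mapping.keys p \<union> Poly_Mapping.keys q"
  have "Poly_Mapping.keys (p + q) \<subseteq> ?S"
    by (rule keys_add)
  then show ?thesis
    by (simp add: mpoly_eval_superset[of ?S] lookup_add distrib_right sum.distrib)
qed

lemma mpoly_eval_sum: "mpoly_eval (sum f S) x = (\<Sum>a\<in>S. mpoly_eval (f a) x)"
  by (induction S rule: infinite_finite_induct) (simp_all add: mpoly_eval_add)

lemma sum_single_keys:
  "(\<Sum>m\<in>Poly_Mapping.keys p. Poly_Mapping.single m (Poly_Mapping.lookup p m)) = p"
  by (rule poly_mapping_eqI)
     (auto simp: lookup_sum lookup_single when_def in_keys_iff sum.delta)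

text \<open>Distributivity reduces the claim to products of two monomials, where the exponents add
  and the coefficients multiply.\<close>

lemma mpoly_eval_mult: "mpoly_eval (p * q) x = mpoly_eval p x * mpoly_eval q x"
proof -
  let ?s = "\<lambda>p m. Poly_Mapping.single m (Poly_Mapping.lookup p m)"
  have "p * q = (\<Sum>a\<in>Poly_Mapping.keys p. \<Sum>b\<in>Poly_Mapping.keys q. ?s p a * ?s q b)"
    by (simp only: sum_product [symmetric] sum_single_keys)
  then have "mpoly_eval (p * q) x =
      (\<Sum>a\<in>Poly_Mapping.keys p. \<Sum>b\<in>Poly_Mapping.keys q. mpoly_eval (?s p a) x * mpoly_eval (?s q b) x)"
    by (simp add: mpoly_eval_sum mult_single lookup_add power_add prod.distrib algebra_simps)
  also have "\<dots> = mpoly_eval p x * mpoly_eval q x"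
    by (simp only: sum_product [symmetric] mpoly_eval_sum [symmetric] sum_single_keys)
  finally show ?thesis .
qed

text \<open>Evaluation is a ring homomorphism, so it commutes with matrix powers; this carries
  nilpotency of the formal Jacobi matrix over to its value at a point.\<close>

lemma mpoly_eval_matrix_power:
  fixes A :: "'n::finite mpoly ^ 'k ^ 'k"
  shows "mpoly_eval (matrix_power A r $ i $ j) x =
    matrix_power (\<chi> i j. mpoly_eval (A $ i $ j) x) r $ i $ j"
  by (induction r arbitrary: i)
     (simp_all add: mat_def matrix_matrix_mult_def mpoly_eval_sum mpoly_eval_mult)

lemma mpoly_eval_cong:
  assumes "\<And>m j. m \<in> Poly_Mapping.keys p \<Longrightarrow> Poly_Mapping.lookup m j > 0 \<Longrightarrow> x $ j = y $ j"
  shows "mpoly_eval p x = mpoly_eval p y"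
  unfolding mpoly_eval_def
proof (intro sum.cong prod.cong arg_cong2[where f = "(*)"] refl)
  fix m j
  assume "m \<in> Poly_Mapping.keys p"
  with assms[of m j] show "(x $ j) ^ Poly_Mapping.lookup m j = (y $ j) ^ Poly_Mapping.lookup m j"
    by (cases "Poly_Mapping.lookup m j = 0") auto
qed

lemma mpoly_eval_deriv:
  "mpoly_eval (mpoly_deriv j p) x =
    (\<Sum>m\<in>Poly_Mapping.keys p. of_nat (Poly_Mapping.lookup m j) * Poly_Mapping.lookup p m *
       (\<Prod>i\<in>UNIV. (x $ i) ^ Poly_Mapping.lookup (m - Poly_Mapping.single j 1) i))"
  by (simp add: mpoly_deriv_def mpoly_eval_sum)

text \<open>The sign pattern of the components of \<open>N\<close>, with \<open>s\<close> as the
  global sign. The weak inequality admits absent monomials and makes the property stable under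
  sums.\<close>

definition alternating_poly :: "real \<Rightarrow> 'n::finite mpoly \<Rightarrow> bool" where
  "alternating_poly s p \<longleftrightarrow>
     (\<forall>m. s * (-1) ^ ((\<Sum>i\<in>UNIV. Poly_Mapping.lookup m i) + 1) * Poly_Mapping.lookup p m \<ge> 0)"

lemma alternating_poly_add:
  "alternating_poly s p \<Longrightarrow> alternating_poly s q \<Longrightarrow> alternating_poly s (p + q)"
  unfolding alternating_poly_def lookup_add distrib_left by (blast intro: add_nonneg_nonneg)

lemma alternating_poly_sum:
  "(\<And>a. a \<in> S \<Longrightarrow> alternating_poly s (f a)) \<Longrightarrow> alternating_poly s (sum f S)"
  by (induction S rule: infinite_finite_induct)
     (simp_all add: alternating_poly_add, simp_all add: alternating_poly_def)

lemma alternating_poly_uminus: "alternating_poly s (- p) \<longleftrightarrow> alternating_poly (- s) p"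
  by (simp add: alternating_poly_def)

lemma alternating_poly_signed_positive_form:
  fixes p :: "'n::finite mpoly"
  assumes "positive_form d p"
  shows "alternating_poly 1 ((-1) ^ (d + 1) * p)"
  unfolding alternating_poly_def
proof
  fix m :: "'n \<Rightarrow>\<^sub>0 nat"
  let ?n = "\<Sum>i\<in>UNIV. Poly_Mapping.lookup m i"
  show "1 * (-1) ^ (?n + 1) * Poly_Mapping.lookup ((-1) ^ (d + 1) * p) m \<ge> 0"
  proof (cases "m \<in> Poly_Mapping.keys p")
    case True
    with assms have "?n = d" "Poly_Mapping.lookup p m > 0"
      by (auto simp: positive_form_def homogeneous_form_def)
    then show ?thesis
      by (cases "even d") simp_all
  next
    case False
    then show ?thesis
      by (cases "even d") (simp_all add: in_keys_iff)
  qed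
qed

text \<open>Here \<open>- 1\<close> is the vector with all coordinates -1. Differentiation lowers
  the degree by one, so the sign of the monomial at this vector cancels the alternating sign of the
  coefficient, and terms of different degrees cannot cancel each other.\<close>

lemma alternating_poly_deriv_term:
  assumes "alternating_poly s p"
  shows "s * (of_nat (Poly_Mapping.lookup m j) * Poly_Mapping.lookup p m *
     (\<Prod>i\<in>UNIV. ((- 1) $ i) ^ Poly_Mapping.lookup (m - Poly_Mapping.single j 1) i)) =
     of_nat (Poly_Mapping.lookup m j) * \<bar>s * Poly_Mapping.lookup p m\<bar>"
proof (cases "Poly_Mapping.lookup m j = 0")
  case False
  let ?n = "\<Sum>i\<in>UNIV. Poly_Mapping.lookup m i"
  let ?k = "\<Sum>i\<in>UNIV. Poly_Mapping.lookup (m - Poly_Mapping.single j 1) i"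
  \<comment> \<open>The exponent of \<open>j\<close> is nonzero, so the subtraction does not
    truncate.\<close>
  have "Poly_Mapping.lookup m i = Poly_Mapping.lookup (m - Poly_Mapping.single j 1) i + (if i = j then 1 else 0)" for i
    using False by (auto simp: lookup_minus lookup_single)
  then have "?n = ?k + 1"
    by (simp add: sum.distrib)
  moreover have "s * (-1) ^ (?n + 1) * Poly_Mapping.lookup p m \<ge> 0"
    using assms by (auto simp: alternating_poly_def)
  ultimately have "0 \<le> (-1) ^ ?k * (s * Poly_Mapping.lookup p m)"
    by (simp add: algebra_simps)
  then have "(-1) ^ ?k * (s * Poly_Mapping.lookup p m) = \<bar>s * Poly_Mapping.lookup p m\<bar>"
    by (cases "even ?k") simp_all
  then show ?thesis
    by (simp add: power_sum [symmetric] algebra_simps)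
qed simp

lemma alternating_poly_deriv_nonneg:
  assumes "alternating_poly s p"
  shows "s * mpoly_eval (mpoly_deriv j p) (- 1) \<ge> 0"
  unfolding mpoly_eval_deriv sum_distrib_left alternating_poly_deriv_term[OF assms]
  by (intro sum_nonneg) simp

text \<open>The term of \<open>m\<close> is positive and no other term is negative.\<close>

lemma alternating_poly_deriv_pos:
  assumes "alternating_poly s p" "s \<noteq> 0" "m \<in> Poly_Mapping.keys p" "Poly_Mapping.lookup m j > 0"
  shows "s * mpoly_eval (mpoly_deriv j p) (- 1) > 0"
  unfolding mpoly_eval_deriv sum_distrib_left alternating_poly_deriv_term[OF assms(1)]
  by (rule sum_pos2[of _ m]) (use assms in \<open>auto simp: in_keys_iff\<close>)

text \<open>Used to put the sign \<open>s\<close> in front of the Jacobi matrix without losing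
  nilpotency.\<close>

lemma matrix_power_scale:
  fixes A :: "'a::comm_semiring_1 ^ 'n ^ 'n"
  shows "matrix_power (\<chi> i j. c * A $ i $ j) r $ i $ j = c ^ r * matrix_power A r $ i $ j"
  by (induction r arbitrary: i)
     (simp_all add: mat_def matrix_matrix_mult_def sum_distrib_left algebra_simps)

lemma matrix_power_nonneg:
  fixes A :: "'a::linordered_semidom ^ 'n ^ 'n"
  assumes "\<And>i j. A $ i $ j \<ge> 0"
  shows "matrix_power A r $ i $ j \<ge> 0"
  by (induction r arbitrary: i) (auto simp: mat_def matrix_matrix_mult_def assms intro!: sum_nonneg)

text \<open>An entry of the power sums, over all walks of length \<open>r\<close>, the products of
  the entries passed. All summands are nonnegative, and the walk along \<open>f\<close> contributes
  a positive one.\<close>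

lemma matrix_power_walk_pos:
  fixes A :: "'a::linordered_semidom ^ 'n::finite ^ 'n"
  assumes "\<And>i j. A $ i $ j \<ge> 0" and "\<And>l. A $ f l $ f (Suc l) > 0"
  shows "matrix_power A r $ f k $ f (k + r) > 0"
proof (induction r arbitrary: k)
  case (Suc r)
  have "A $ f k $ f (Suc k) * matrix_power A r $ f (Suc k) $ f (k + Suc r) > 0"
    using Suc[of "Suc k"] assms(2) by simp
  then show ?case
    by (auto simp: matrix_matrix_mult_def intro!: sum_pos2[of _ "f (Suc k)"] mult_nonneg_nonneg
      assms(1) matrix_power_nonneg)
qed (simp add: mat_def)

lemma nonneg_nilpotent_matrix_wf:
  fixes A :: "'a::linordered_semidom ^ 'n::finite ^ 'n"
  assumes "\<And>i j. A $ i $ j \<ge> 0" and "matrix_power A r = 0"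
  shows "wf {(j, i). A $ i $ j > 0}"
  unfolding wf_iff_no_infinite_down_chain
proof
  assume "\<exists>f. \<forall>l. (f (Suc l), f l) \<in> {(j, i). A $ i $ j > 0}"
  then obtain f where "\<And>l. A $ f l $ f (Suc l) > 0"
    by auto
  then have "matrix_power A r $ f 0 $ f (0 + r) > 0"
    by (intro matrix_power_walk_pos assms(1))
  with assms(2) show False
    by simp
qed

theorem mainTheorem9:
  fixes N :: "'n::finite morphism"
    and F :: "nat \<Rightarrow> 'n morphism"
    and m :: nat
  assumes "nilpotent_morphism N"
    and "\<And>i k. 1 \<le> i \<Longrightarrow> i \<le> m \<Longrightarrow> positive_form i (F i $ k)"
    and "N = (\<Sum>i=1..m. (-1) ^ (i + 1) *s F i) \<or>
         N = - (\<Sum>i=1..m. (-1) ^ (i + 1) *s F i)"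
  shows "\<exists>\<^sub>\<le>\<^sub>1x. fixed_point N x"
proof -
  have "alternating_poly 1 ((\<Sum>i=1..m. (-1) ^ (i + 1) *s F i) $ k)" for k
    unfolding sum_component vector_smult_component
    by (intro alternating_poly_sum alternating_poly_signed_positive_form assms(2)) auto
  \<comment> \<open>\<open>s\<close> is the global sign of \<open>N\<close>: 1 or -1 according to
    the case of the hypothesis.\<close>
  then obtain s :: real where "s \<noteq> 0" and alt: "\<And>k. alternating_poly s (N $ k)"
    using assms(3) that[of 1] that[of "- 1"] by (auto simp: alternating_poly_uminus)
  \<comment> \<open>The nested form exposes first the scaling and then the evaluation, so that the
    lemmas on matrix powers rewrite the powers of \<open>A\<close> to those of the formal Jacobi
    matrix.\<close>
  define A :: "real ^ 'n ^ 'n" where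
    "A = (\<chi> i j. s * (\<chi> i j. mpoly_eval (jacobi_matrix N $ i $ j) (- 1)) $ i $ j)"
  have A: "A $ i $ j = s * mpoly_eval (mpoly_deriv j (N $ i)) (- 1)" for i j
    by (simp add: A_def jacobi_matrix_def)
  have "matrix_power A CARD('n) = 0"
    using assms(1) unfolding vec_eq_iff A_def matrix_power_scale mpoly_eval_matrix_power [symmetric]
    by (simp add: nilpotent_morphism_def)
  then have wf: "wf {(j, i). A $ i $ j > 0}"
    by (intro nonneg_nilpotent_matrix_wf) (simp_all add: A alternating_poly_deriv_nonneg alt)
  show ?thesis
  proof (rule Uniq_I)
    fix x y
    assume "fixed_point N x" "fixed_point N y"
    then have fixed: "x $ i = mpoly_eval (N $ i) x" "y $ i = mpoly_eval (N $ i) y" for i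
      by (auto simp: fixed_point_def morphism_eval_def vec_eq_iff)
    have "x $ i = y $ i" for i
      using wf
    proof (induction i rule: wf_induct_rule)
      case (less i)
      \<comment> \<open>Only variables occurring in \<open>N $ i\<close> matter; each of them has a
        positive entry in row \<open>i\<close> of \<open>A\<close>, so the induction hypothesis
        applies to it.\<close>
      have "mpoly_eval (N $ i) x = mpoly_eval (N $ i) y"
        by (rule mpoly_eval_cong, rule less)
           (simp add: A alternating_poly_deriv_pos[OF alt \<open>s \<noteq> 0\<close>])
      with fixed show ?case
        by simp
    qed
    then show "x = y"
      by (simp add: vec_eq_iff)
  qed
qed

end
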